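(* Let $\Phi$ be a finite ergodic open quantum random walk with degree of freedom $n\ge 2$ and $k\ge 2$ sites, let $\hat{\mathcal Z}$ be its fundamental matrix and $\hat K=(\hat k_{ij})$ its mean hitting time operator. Let $\hat D$ be the block-diagonal operator with diagonal entries $\hat k_{11},\dots,\hat k_{kk}$ and let $\hat N:=\hat K-\hat D$. If $\hat D$ is invertible and there is a constant $c$ such that $\mathrm{Tr}(\hat k_{ii}\eta)=c\,\mathrm{Tr}(\eta)$ for all $i=1,\dots,k$ and all $\eta\in M_n(\mathbb C)$, then for every density matrix $\rho\in M_n(\mathbb C)$ and all $i,j=1,\dots,k$, $$\mathrm{Tr}\big((\hat D^{-1}\hat N)_{ij}\rho\big)=\mathrm{Tr}\big([\hat{\mathcal Z}_{ii}-\hat{\mathcal Z}_{ij}]\rho\big).$$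
   Context: OQW. Let $k$ (number of sites) and $n$ (degree of freedom) be positive integers. A finite open quantum random walk (OQW) $\Phi$ is given by matrices $B_{ij}\in M_n(\mathbb C)$, $i,j=1,\dots,k$, with $\sum_{i=1}^k B_{ij}^*B_{ij}=I$ for each $j$; $B_{ij}$ is the effect of passing from site $j$ to site $i$. For $C\in M_n(\mathbb C)$ let $M_C:M_n(\mathbb C)\to M_n(\mathbb C)$, $M_C(X)=CXC^*$. Block operators. A block operator is a $k\times k$ array $\hat A=(\hat A_{ij})$ of linear maps $\hat A_{ij}:M_n(\mathbb C)\to M_n(\mathbb C)$, acting on column vectors in $M_n(\mathbb C)^k$; products are block matrix products, $(\hat A\hat B)_{ij}=\sum_{l}\hat A_{il}\hat B_{lj}$ (composition of maps), and $\hat I$ is the identity. $\hat A_{ij}\rho$ denotes $\hat A_{ij}(\rho)$. The block representation of $\Phi$ is $\hat\Phi=(\hat\Phi_{ij})$, $\hat\Phi_{ij}=M_{B_{ij}}$. Ergodicity. $\hat\Omega$ is the block operator all of whose blocks $\hat\Omega_{pq}$, $p,q=1,\dots,k$, are equal to $X\mapsto\frac{1}{kn}\mathrm{Tr}(X)I_n$ (with respect to row-stacking vectorization, its matrix is $\frac1{kn}\sum_{a,b=1}^nE_{ab}\otimes E_{ab}$ with $E_{ab}\in M_n(\mathbb C)$ the matrix units). $\Phi$ is called ergodic if $\hat\Phi^r\to\hat\Omega$ as $r\to\infty$ (entrywise convergence of matrix representations). Fundamental matrix. For $\Phi$ ergodic, $\hat{\mathcal Z}:=\hat I+\sum_{r\ge1}(\hat\Phi^r-\hat\Omega)=(\hat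 I-\hat\Phi+\hat\Omega)^{-1}$. Mean hitting time operator. For $r\ge1$ let $\pi(i\leftarrow j;r)$ be the collection of products $C=B_{i_r i_{r-1}}\cdots B_{i_2i_1}B_{i_1i_0}$, one for each sequence of sites with $i_0=j$, $i_r=i$ and $i_1,\dots,i_{r-1}\neq i$ (first visit to $i$ after time $0$ at step $r$; for $i=j$, first return). Then $\hat K=(\hat k_{ij})_{i,j=1}^k$ with $\hat k_{ij}:=\sum_{r\ge1} r\sum_{C\in\pi(i\leftarrow j;r)}M_C$. A density matrix is a positive semidefinite $\rho\in M_n(\mathbb C)$ with $\mathrm{Tr}(\rho)=1$. *)

theory Defs
  imports "HOL-Analysis.Analysis"
begin

type_synonym 'n cmat = "complex^'n^'n"

definition ctranspose :: "'n::finite cmat \<Rightarrow> 'n cmat" where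
  "ctranspose A = transpose (map_matrix cnj A)"

definition matrix_unit :: "'n::finite \<Rightarrow> 'n \<Rightarrow> 'n cmat" where
  "matrix_unit a b = (\<chi> c d. if c = a \<and> d = b then 1 else 0)"

text \<open>The real part and imaginary part of \<open>v\<^sup>* A v\<close> are constrained separately,
  since there is no order on \<^typ>\<open>complex\<close> here.\<close>

definition psd :: "'n::finite cmat \<Rightarrow> bool" where
  "psd A \<longleftrightarrow> ctranspose A = A \<and>
     (\<forall>v::complex^'n. let q = (\<Sum>a\<in>UNIV. \<Sum>b\<in>UNIV. cnj (v $ a) * A $ a $ b * v $ b)
        in Im q = 0 \<and> 0 \<le> Re q)"

definition density_matrix :: "'n::finite cmat \<Rightarrow> bool" where
  "density_matrix \<rho> \<longleftrightarrow> psd \<rho> \<and> trace \<rho> = 1"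

text \<open>The library's \<^const>\<open>linear\<close> is linearity over the reals; maps on complex matrices
  are here required to be linear over the complex numbers.\<close>

definition clinear_map :: "('n::finite cmat \<Rightarrow> 'n cmat) \<Rightarrow> bool" where
  "clinear_map f \<longleftrightarrow>
     Vector_Spaces.linear (\<lambda>a. map_matrix ((*) a)) (\<lambda>a. map_matrix ((*) a)) f"

lemma clinear_map_iff:
  "clinear_map f \<longleftrightarrow>
     (\<forall>X Y. f (X + Y) = f X + f Y) \<and> (\<forall>a X. f (map_matrix ((*) a) X) = map_matrix ((*) a) (f X))"
proof -
  have "vector_space (\<lambda>a. map_matrix ((*) a) :: 'n::finite cmat \<Rightarrow> 'n cmat)"
    by unfold_locales (auto simp: vec_eq_iff algebra_simps)
  then show ?thesis
    unfolding clinear_map_def linear_iff_module_hom module_hom_iff vector_space_def module_def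
    by auto
qed

definition conj_map :: "'n::finite cmat \<Rightarrow> 'n cmat \<Rightarrow> 'n cmat" where
  "conj_map C X = C ** X ** ctranspose C"


section \<open>Block operators\<close>

text \<open>A block operator is an array of complex-linear maps (\<open>is_block_op\<close>), with sites indexed
  by the finite type \<^typ>\<open>'k\<close> and \<open>n = CARD('n)\<close>.\<close>

type_synonym ('k, 'n) block_op = "'k \<Rightarrow> 'k \<Rightarrow> 'n cmat \<Rightarrow> 'n cmat"

definition is_block_op :: "('k::finite, 'n::finite) block_op \<Rightarrow> bool" where
  "is_block_op A \<longleftrightarrow> (\<forall>i j. clinear_map (A i j))"

definition block_id :: "('k::finite, 'n::finite) block_op" where
  "block_id i j = (if i = j then (\<lambda>X. X) else (\<lambda>X. 0))"

definition block_mult ::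
  "('k::finite, 'n::finite) block_op \<Rightarrow> ('k, 'n) block_op \<Rightarrow> ('k, 'n) block_op" where
  "block_mult A B i j = (\<lambda>X. \<Sum>l\<in>UNIV. A i l (B l j X))"

primrec block_power :: "('k::finite, 'n::finite) block_op \<Rightarrow> nat \<Rightarrow> ('k, 'n) block_op" where
  "block_power A 0 = block_id"
| "block_power A (Suc r) = block_mult A (block_power A r)"

definition block_is_inverse ::
  "('k::finite, 'n::finite) block_op \<Rightarrow> ('k, 'n) block_op \<Rightarrow> bool" where
  "block_is_inverse A B \<longleftrightarrow>
     is_block_op B \<and> block_mult A B = block_id \<and> block_mult B A = block_id"

definition block_invertible :: "('k::finite, 'n::finite) block_op \<Rightarrow> bool" where
  "block_invertible A \<longleftrightarrow> (\<exists>B. block_is_inverse A B)"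

definition block_inv :: "('k::finite, 'n::finite) block_op \<Rightarrow> ('k, 'n) block_op" where
  "block_inv A = (SOME B. block_is_inverse A B)"

definition block_diag_part :: "('k::finite, 'n::finite) block_op \<Rightarrow> ('k, 'n) block_op" where
  "block_diag_part A i j = (if i = j then A i i else (\<lambda>X. 0))"


section \<open>Open quantum random walks\<close>

text \<open>\<open>B i j\<close> is the effect of passing from site \<open>j\<close> to site \<open>i\<close>.\<close>

definition oqw :: "('k::finite \<Rightarrow> 'k \<Rightarrow> 'n::finite cmat) \<Rightarrow> bool" where
  "oqw B \<longleftrightarrow> (\<forall>j. (\<Sum>i\<in>UNIV. ctranspose (B i j) ** B i j) = mat 1)"

definition block_rep :: "('k::finite \<Rightarrow> 'k \<Rightarrow> 'n::finite cmat) \<Rightarrow> ('k, 'n) block_op" where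
  "block_rep B i j = conj_map (B i j)"

definition Omega :: "('k::finite, 'n::finite) block_op" where
  "Omega p q = (\<lambda>X. mat (trace X / (of_nat CARD('k) * of_nat CARD('n))))"

text \<open>Entrywise convergence: the coefficients of the matrix of a linear map on \<open>M\<^sub>n\<close> are the
  entries of the images of the matrix units.\<close>

definition ergodic :: "('k::finite \<Rightarrow> 'k \<Rightarrow> 'n::finite cmat) \<Rightarrow> bool" where
  "ergodic B \<longleftrightarrow>
     (\<forall>p q a b c d.
        (\<lambda>r. block_power (block_rep B) r p q (matrix_unit a b) $ c $ d)
          \<longlonglongrightarrow> (Omega :: ('k, 'n) block_op) p q (matrix_unit a b) $ c $ d)"

text \<open>Infinite sums of block operators are taken blockwise and pointwise; as the spaces are
  finite-dimensional this agrees with entrywise summation.\<close>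

definition fundamental :: "('k::finite \<Rightarrow> 'k \<Rightarrow> 'n::finite cmat) \<Rightarrow> ('k, 'n) block_op" where
  "fundamental B i j =
     (\<lambda>X. block_id i j X
        + (\<Sum>r. block_power (block_rep B) (Suc r) i j X - (Omega :: ('k, 'n) block_op) i j X))"

text \<open>A sequence of sites \<open>i\<^sub>0, \<dots>, i\<^sub>r\<close> is the list \<open>[i\<^sub>0, \<dots>, i\<^sub>r]\<close>.\<close>

definition first_visit_seqs :: "'k::finite \<Rightarrow> 'k \<Rightarrow> nat \<Rightarrow> 'k list set" where
  "first_visit_seqs i j r =
     {s. length s = Suc r \<and> s ! 0 = j \<and> s ! r = i \<and> (\<forall>m. 0 < m \<and> m < r \<longrightarrow> s ! m \<noteq> i)}"

fun seq_effect :: "('k::finite \<Rightarrow> 'k \<Rightarrow> 'n::finite cmat) \<Rightarrow> 'k list \<Rightarrow> 'n cmat" where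
  "seq_effect B (x # y # s) = seq_effect B (y # s) ** B y x"
| "seq_effect B s = mat 1"

text \<open>The sums below range over sequences of sites and not over the set of their products:
  different sequences with the same product contribute separately.
  The summation index is shifted: the number of steps is \<open>Suc r \<ge> 1\<close>.\<close>

definition mean_hitting_time ::
  "('k::finite \<Rightarrow> 'k \<Rightarrow> 'n::finite cmat) \<Rightarrow> ('k, 'n) block_op" where
  "mean_hitting_time B i j =
     (\<lambda>X. \<Sum>r. real (Suc r) *\<^sub>R
        (\<Sum>s\<in>first_visit_seqs i j (Suc r). conj_map (seq_effect B s) X))"

end

theory Submission
  imports Defs
begin

text \<open>
  Write \<open>F\<close> for the walk acting on columns, and fix a site \<open>i\<close>. Let \<open>Q\<close> be \<open>F\<close> followed by erasing
  the \<open>i\<close>-th entry, so that a first visit to \<open>i\<close> at step \<open>r + 1\<close> is \<open>(F Q\<^sup>r x)\<^sub>i\<close>. Ergodicity makes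
  both \<open>(F - \<Omega>)\<^sup>r\<close> and \<open>Q\<^sup>r\<close> decay geometrically: for \<open>Q\<close>, because after enough steps any positive
  column has about the fraction \<open>1 / k\<close> of its trace at \<open>i\<close>, which \<open>Q\<close> loses. Hence all series
  converge.

  Let \<open>\<nu> x\<close> be the trace of the \<open>i\<close>-th entry of \<open>N x\<close>. Conditioning on the first step, and using
  that \<open>i\<close> is almost surely hit, gives \<open>\<nu> x + c Tr x\<^sub>i = Tr x + \<nu> (F x)\<close>. For \<open>x = Z y\<close>, where
  \<open>Z y - F (Z y) = y - \<Omega> y\<close>, this reads \<open>\<nu> y = \<nu> (\<Omega> y) + Tr y - c Tr (Z y)\<^sub>i\<close>. Here \<open>\<Omega> y\<close>
  depends on \<open>Tr y\<close> only, so placing \<open>\<rho>\<close> at \<open>j\<close> or at \<open>i\<close> and subtracting yields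
  \<open>Tr (N\<^sub>i\<^sub>j \<rho>) = c Tr (Z\<^sub>i\<^sub>i \<rho> - Z\<^sub>i\<^sub>j \<rho>)\<close>, while the diagonal blocks of the inverse of \<open>D\<close>
  divide traces by \<open>c\<close>.
\<close>

section \<open>Geometric decay of iterates in finite dimension\<close>

text \<open>Expanding \<open>x\<close> in the finite basis reduces uniform smallness of a linear map
  to its values on basis vectors.\<close>

lemma norm_linear_le_sum_Basis:
  fixes f :: "'a::euclidean_space \<Rightarrow> 'b::real_normed_vector"
  assumes "linear f"
  shows "norm (f x) \<le> (\<Sum>b\<in>Basis. norm (f b)) * norm x"
proof -
  have "f x = f (\<Sum>b\<in>Basis. (x \<bullet> b) *\<^sub>R b)"
    by (simp add: euclidean_representation)
  also have "\<dots> = (\<Sum>b\<in>Basis. (x \<bullet> b) *\<^sub>R f b)"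
    using assms by (simp add: linear_sum linear_cmul o_def)
  finally have "norm (f x) \<le> (\<Sum>b\<in>Basis. norm ((x \<bullet> b) *\<^sub>R f b))"
    by (metis norm_sum)
  also have "\<dots> \<le> (\<Sum>b\<in>Basis. norm (f b) * norm x)"
    by (intro sum_mono) (simp add: Basis_le_norm mult.commute[of _ "norm x"] mult_right_mono)
  finally show ?thesis
    by (simp add: sum_distrib_right)
qed

lemma linear_funpow:
  fixes f :: "'a::real_vector \<Rightarrow> 'a"
  assumes "linear f"
  shows "linear (f ^^ r)"
proof (induction r)
  case 0
  show ?case by (rule linearI) simp_all
next
  case (Suc r)
  then show ?case using linear_compose[OF Suc assms] by (simp add: o_def)
qed

text \<open>Convergence on the finitely many basis vectors makes one power \<open>T ^^ R\<close>
  halve norms; dividing \<open>r\<close> by \<open>R\<close> with remainder then gives the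
  rate.\<close>

lemma funpow_geometric_decay:
  fixes T :: "'a::euclidean_space \<Rightarrow> 'a"
  assumes lin: "linear T" and lim: "\<And>x. (\<lambda>r. (T ^^ r) x) \<longlonglongrightarrow> 0"
  obtains C q where "0 \<le> C" "0 \<le> q" "q < 1" "\<And>r x. norm ((T ^^ r) x) \<le> C * q ^ r * norm x"
proof -
  have "(\<lambda>r. \<Sum>b\<in>Basis. norm ((T ^^ r) b)) \<longlonglongrightarrow> (\<Sum>b\<in>(Basis :: 'a set). norm (0::'a))"
    by (intro tendsto_sum tendsto_norm lim)
  then have "eventually (\<lambda>r. (\<Sum>b\<in>Basis. norm ((T ^^ r) b)) < 1 / 2) sequentially"
    by (rule order_tendstoD) simp
  then have "eventually (\<lambda>r. (\<Sum>b\<in>Basis. norm ((T ^^ r) b)) < 1 / 2 \<and> 0 < r) sequentially"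
    by (intro eventually_conj eventually_gt_at_top)
  then obtain R where R: "(\<Sum>b\<in>Basis. norm ((T ^^ R) b)) < 1 / 2" "0 < R"
    by (metis (mono_tags, lifting) eventually_sequentially order_refl)
  have half: "norm ((T ^^ R) x) \<le> 1 / 2 * norm x" for x
    using norm_linear_le_sum_Basis[OF linear_funpow[OF lin], of R x] R(1)
    by (smt (verit, best) mult_right_mono norm_ge_zero)
  have blocks: "norm (((T ^^ R) ^^ m) x) \<le> (1 / 2) ^ m * norm x" for m x
  proof (induction m)
    case (Suc m)
    then show ?case using half[of "((T ^^ R) ^^ m) x"] by simp
  qed simp
  define M where "M = (\<Sum>s<R. \<Sum>b\<in>Basis. norm ((T ^^ s) b))"
  have M0: "0 \<le> M" unfolding M_def by (intro sum_nonneg) simp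
  have M: "norm ((T ^^ s) x) \<le> M * norm x" if "s < R" for s x
  proof -
    have "(\<Sum>b\<in>Basis. norm ((T ^^ s) b)) \<le> M"
      unfolding M_def using that by (intro member_le_sum) (auto intro: sum_nonneg)
    with norm_linear_le_sum_Basis[OF linear_funpow[OF lin], of s x] show ?thesis
      by (smt (verit, best) mult_right_mono norm_ge_zero)
  qed
  \<comment> \<open>The rate is chosen so that \<open>R\<close> steps cost exactly the factor
    1/2.\<close>
  define q where "q = root R (1 / 2)"
  have q: "0 < q" "q < 1" "q ^ R = 1 / 2"
    using R(2) by (simp_all add: q_def)
  have "norm ((T ^^ r) x) \<le> 2 * M * q ^ r * norm x" for r x
  proof -
    have "T ^^ r = T ^^ (R * (r div R) + r mod R)" by simp
    also have "\<dots> = ((T ^^ R) ^^ (r div R)) \<circ> (T ^^ (r mod R))"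
      by (simp only: funpow_add funpow_mult)
    finally have "norm ((T ^^ r) x) = norm (((T ^^ R) ^^ (r div R)) ((T ^^ (r mod R)) x))"
      by simp
    also have "\<dots> \<le> (1 / 2) ^ (r div R) * (M * norm x)"
      by (rule order_trans[OF blocks]) (simp add: M R(2) mult_left_mono)
    \<comment> \<open>Rounding down to full blocks costs at most a factor 2, as
      \<open>q ^ (r mod R)\<close> is at least \<open>q ^ R = 1 / 2\<close>.\<close>
    also have "(1 / 2) ^ (r div R) \<le> 2 * q ^ r"
    proof -
      have "q ^ R \<le> q ^ (r mod R)"
        using q R(2) by (intro power_decreasing) (auto simp: less_imp_le)
      then have "(1 / 2) ^ (r div R) * (1 / 2) \<le> (1 / 2) ^ (r div R) * q ^ (r mod R)"
        using q by (intro mult_left_mono) auto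
      also have "\<dots> = q ^ (R * (r div R) + r mod R)"
        by (simp only: power_add power_mult q(3))
      finally show ?thesis by simp
    qed
    then have "(1 / 2) ^ (r div R) * (M * norm x) \<le> 2 * q ^ r * (M * norm x)"
      using M0 by (intro mult_right_mono) auto
    finally show ?thesis by (simp add: mult_ac)
  qed
  with that[of "2 * M" q] q M0 show thesis by simp
qed

text \<open>A geometric bound also absorbs the linear weight \<open>Suc r\<close> of the hitting
  time series.\<close>

lemma summable_funpow:
  fixes T :: "'a::euclidean_space \<Rightarrow> 'a"
  assumes "linear T" and "\<And>x. (\<lambda>r. (T ^^ r) x) \<longlonglongrightarrow> 0"
  shows "summable (\<lambda>r. real (Suc r) *\<^sub>R (T ^^ r) x)" and "summable (\<lambda>r. (T ^^ r) x)"
proof -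
  obtain C q where Cq: "0 \<le> C" "0 \<le> q" "q < 1" "\<And>r x. norm ((T ^^ r) x) \<le> C * q ^ r * norm x"
    using funpow_geometric_decay[OF assms] by blast
  have "summable (\<lambda>r. C * norm x * (real (Suc r) * q ^ r))"
    using geometric_deriv_sums[of q] Cq by (intro summable_mult) (auto simp: sums_iff)
  then show "summable (\<lambda>r. real (Suc r) *\<^sub>R (T ^^ r) x)"
  proof (rule summable_comparison_test')
    show "norm (real (Suc r) *\<^sub>R (T ^^ r) x) \<le> C * norm x * (real (Suc r) * q ^ r)" for r
      using mult_left_mono[OF Cq(4)[of r x], of "real (Suc r)"] by (simp add: mult_ac)
  qed
  have "summable (\<lambda>r. C * norm x * q ^ r)"
    using Cq by (intro summable_mult summable_geometric) auto
  then show "summable (\<lambda>r. (T ^^ r) x)"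
    by (rule summable_comparison_test') (use Cq(4) in \<open>simp add: mult_ac\<close>)
qed

section \<open>Block operators acting on columns\<close>

text \<open>Columns form a Euclidean space, so the decay results above reach block operators through
  this action.\<close>

definition block_apply ::
  "('k::finite, 'n::finite) block_op \<Rightarrow> 'n cmat ^ 'k \<Rightarrow> 'n cmat ^ 'k" where
  "block_apply A x = (\<chi> p. \<Sum>q\<in>UNIV. A p q (x $ q))"

definition total_trace :: "'n::finite cmat ^ 'k::finite \<Rightarrow> complex" where
  "total_trace x = (\<Sum>p\<in>UNIV. trace (x $ p))"

text \<open>Scaling in the vector type is real, while matrix units span only over the complex
  numbers.\<close>

definition cscale :: "complex \<Rightarrow> 'n::finite cmat ^ 'k::finite \<Rightarrow> 'n cmat ^ 'k" where
  "cscale c x = (\<chi> p a b. c * x $ p $ a $ b)"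

section \<open>Conjugation maps and preservation of the trace\<close>

lemma conj_map_nth:
  "conj_map C X $ c $ d = (\<Sum>b\<in>UNIV. \<Sum>a\<in>UNIV. C $ c $ a * X $ a $ b * cnj (C $ d $ b))"
  by (simp add: conj_map_def ctranspose_def transpose_def map_matrix_def matrix_matrix_mult_def
      sum_distrib_right)

lemma linear_conj_map: "linear (conj_map C)"
  by (rule linearI)
    (simp_all add: vec_eq_iff conj_map_nth algebra_simps sum.distrib scaleR_sum_right)

lemma ctranspose_mult: "ctranspose (A ** B) = ctranspose B ** ctranspose A"
  by (simp add: ctranspose_def vec_eq_iff transpose_def matrix_matrix_mult_def map_matrix_def
      mult.commute)

lemma conj_map_mult: "conj_map (A ** B) X = conj_map A (conj_map B X)"
  by (simp add: conj_map_def ctranspose_mult matrix_mul_assoc)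

lemma linear_trace: "linear (trace :: 'n::finite cmat \<Rightarrow> complex)"
  by (rule linearI) (simp_all add: trace_def sum.distrib scaleR_sum_right)

lemma matrix_mult_add_left:
  "(A + B) ** (X :: 'n::finite cmat) = A ** X + B ** X"
  by (simp add: vec_eq_iff matrix_matrix_mult_def algebra_simps sum.distrib)

lemma matrix_mult_sum_left:
  "(\<Sum>i\<in>S. A i) ** (X :: 'n::finite cmat) = (\<Sum>i\<in>S. A i ** X)"
  by (induction S rule: infinite_finite_induct) (simp_all add: matrix_mult_add_left)

text \<open>Cyclicity of the trace moves each \<open>B i j\<close> next to its adjoint, and the sum
  over \<open>i\<close> collapses to the identity.\<close>

lemma oqw_trace_preserving:
  assumes "oqw B"
  shows "(\<Sum>i\<in>UNIV. trace (conj_map (B i j) X)) = trace X"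
proof -
  have "trace (conj_map (B i j) X) = trace (ctranspose (B i j) ** B i j ** X)" for i
    unfolding conj_map_def by (metis matrix_mul_assoc trace_mul_sym)
  then have "(\<Sum>i\<in>UNIV. trace (conj_map (B i j) X)) =
      trace ((\<Sum>i\<in>UNIV. ctranspose (B i j) ** B i j) ** X)"
    by (simp add: matrix_mult_sum_left linear_sum[OF linear_trace] o_def)
  with assms show ?thesis by (simp add: oqw_def)
qed

lemma linear_block_apply:
  assumes "\<And>p q. linear (A p q)"
  shows "linear (block_apply A)"
  by (rule linearI)
    (simp_all add: block_apply_def vec_eq_iff linear_add[OF assms] linear_cmul[OF assms]
      sum.distrib scaleR_sum_right)

lemma block_apply_axis:
  assumes "\<And>q. A p q 0 = 0"
  shows "block_apply A (axis q X) $ p = A p q X"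
proof -
  have "A p l (axis q X $ l) = (if l = q then A p q X else 0)" for l
    by (simp add: axis_def assms)
  then show ?thesis by (simp add: block_apply_def)
qed

lemma block_apply_id: "block_apply block_id x = x"
  unfolding block_apply_def block_id_def vec_eq_iff
  by (simp add: if_distribR cong: if_cong)

lemma linear_block_mult:
  assumes "\<And>p q. linear (A p q)" and "\<And>p q. linear (B p q)"
  shows "linear (block_mult A B p q)"
  by (rule linearI)
    (simp_all add: block_mult_def linear_add[OF assms(1)] linear_add[OF assms(2)]
      linear_cmul[OF assms(1)] linear_cmul[OF assms(2)] sum.distrib scaleR_sum_right)

lemma block_apply_mult:
  assumes "\<And>p q. linear (A p q)"
  shows "block_apply (block_mult A B) x = block_apply A (block_apply B x)"
  unfolding block_apply_def block_mult_def
  by (simp add: vec_eq_iff linear_sum[OF assms] o_def) (subst sum.swap, simp)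

lemma linear_block_power:
  assumes "\<And>p q. linear (A p q)"
  shows "linear (block_power A r p q)"
proof (induction r arbitrary: p q)
  case 0
  then show ?case by (auto simp: block_id_def intro: linearI)
next
  case (Suc r)
  then show ?case by (simp add: linear_block_mult assms)
qed

lemma block_apply_power:
  assumes "\<And>p q. linear (A p q)"
  shows "block_apply (block_power A r) x = (block_apply A ^^ r) x"
  by (induction r) (simp_all add: block_apply_id block_apply_mult assms)

lemma linear_block_rep: "linear (block_rep B p q)"
  by (simp add: block_rep_def linear_conj_map)

lemma linear_Omega: "linear ((Omega :: ('k::finite, 'a::finite) block_op) p q)"
proof (rule linearI)
  show "Omega p q (X + Y) = Omega p q X + Omega p q Y" for X Y :: "'a cmat"
    by (simp add: Omega_def vec_eq_iff mat_def linear_add[OF linear_trace] add_divide_distrib)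
  show "Omega p q (r *\<^sub>R X) = r *\<^sub>R Omega p q X" for r and X :: "'a cmat"
    using linear_cmul[OF linear_trace, of r X]
    by (simp add: Omega_def vec_eq_iff mat_def scaleR_conv_of_real[where 'a = complex])
qed

section \<open>Total trace under the walk and under \<open>Omega\<close>\<close>

lemma linear_total_trace: "linear total_trace"
  by (rule linearI)
    (simp_all add: total_trace_def linear_add[OF linear_trace] linear_cmul[OF linear_trace]
      sum.distrib scaleR_sum_right)

lemma total_trace_axis [simp]: "total_trace (axis j X) = trace X"
proof -
  have "trace (axis j X $ p) = (if p = j then trace X else 0)" for p
    by (simp add: axis_def linear_0[OF linear_trace])
  then show ?thesis by (simp add: total_trace_def)
qed

lemma total_trace_block_rep:
  assumes "oqw B"
  shows "total_trace (block_apply (block_rep B) x) = total_trace x"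
  unfolding total_trace_def block_apply_def block_rep_def
  by (simp add: linear_sum[OF linear_trace] o_def)
    (subst sum.swap, simp add: oqw_trace_preserving[OF assms])

lemma total_trace_funpow:
  assumes "oqw B"
  shows "total_trace ((block_apply (block_rep B) ^^ r) x) = total_trace x"
  by (induction r) (simp_all add: total_trace_block_rep assms)

lemma block_apply_Omega:
  "block_apply (Omega :: ('k::finite, 'n::finite) block_op) x $ p =
    mat (total_trace x / (of_nat CARD('k) * of_nat CARD('n)))"
  unfolding block_apply_def Omega_def total_trace_def
  by (simp add: vec_eq_iff mat_def sum_divide_distrib)

lemma trace_mat: "trace (mat c :: 'n::finite cmat) = of_nat CARD('n) * c"
  by (simp add: trace_def mat_def)

lemma total_trace_Omega: "total_trace (block_apply Omega x) = total_trace x"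
  unfolding total_trace_def[of "block_apply Omega x"] block_apply_Omega trace_mat by simp

section \<open>Columns spanned by matrix units\<close>

lemma column_eq_sum_units:
  "x = (\<Sum>j\<in>UNIV. \<Sum>a\<in>UNIV. \<Sum>b\<in>UNIV. cscale (x $ j $ a $ b) (axis j (matrix_unit a b)))"
proof -
  have "cscale (x $ j $ a $ b) (axis j (matrix_unit a b)) $ p $ c $ d =
      (if j = p then if a = c then if b = d then x $ p $ c $ d else 0 else 0 else 0)" for j a b p c d
    by (auto simp: cscale_def axis_def matrix_unit_def)
  then show ?thesis
    by (simp add: vec_eq_iff sum.If_cases if_distrib[of "sum _"] cong: if_cong)
qed

text \<open>An induction principle that carries convergence from matrix units, where ergodicity is
  stated, to all columns.\<close>

lemma columns_generated_by_units:
  fixes x :: "'n::finite cmat ^ 'k::finite"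
  assumes add: "\<And>x y. P x \<Longrightarrow> P y \<Longrightarrow> P (x + y)"
    and scale: "\<And>c x. P x \<Longrightarrow> P (cscale c x)"
    and unit: "\<And>j a b. P (axis j (matrix_unit a b))"
  shows "P x"
proof -
  have "cscale 0 y = 0" for y :: "'n cmat ^ 'k"
    by (simp add: cscale_def vec_eq_iff)
  \<comment> \<open>Scaling a unit by 0 settles the empty sum.\<close>
  then have "P 0" using scale[OF unit, of 0] by simp
  have sum_k: "P (\<Sum>s\<in>S. f s)" if "\<And>s. P (f s)" for S and f :: "'k \<Rightarrow> _"
    using that \<open>P 0\<close> by (induction S rule: infinite_finite_induct) (auto intro: add)
  have sum_n: "P (\<Sum>s\<in>S. f s)" if "\<And>s. P (f s)" for S and f :: "'n \<Rightarrow> _"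
    using that \<open>P 0\<close> by (induction S rule: infinite_finite_induct) (auto intro: add)
  show ?thesis
    by (subst column_eq_sum_units) (intro sum_k sum_n scale unit)
qed

lemma tendsto_cscale:
  assumes "(f \<longlongrightarrow> l) F"
  shows "((\<lambda>r. cscale c (f r)) \<longlongrightarrow> cscale c l) F"
  unfolding cscale_def using assms
  by (intro tendsto_vec_lambda tendsto_mult_left tendsto_vec_nth)

lemma funpow_cscale:
  fixes f :: "'n::finite cmat ^ 'k::finite \<Rightarrow> 'n cmat ^ 'k"
  assumes "\<And>x. f (cscale c x) = cscale c (f x)"
  shows "(f ^^ r) (cscale c x) = cscale c ((f ^^ r) x)"
proof (induction r)
  case (Suc r)
  then show ?case by (simp add: assms)
qed simp

lemma block_apply_rep_cscale:
  "block_apply (block_rep B) (cscale c x) = cscale c (block_apply (block_rep B) x)"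
  by (simp add: block_apply_def block_rep_def cscale_def vec_eq_iff conj_map_nth
      sum_distrib_left mult_ac)

lemma block_apply_Omega_cscale:
  "block_apply Omega (cscale c x) = cscale c (block_apply Omega x)"
  unfolding vec_eq_iff[of "block_apply Omega _"] block_apply_Omega
  by (simp add: cscale_def block_apply_Omega vec_eq_iff mat_def total_trace_def trace_def
      sum_distrib_left)

lemma ergodic_tendsto:
  fixes B :: "'k::finite \<Rightarrow> 'k \<Rightarrow> 'n::finite cmat" and x :: "'n cmat ^ 'k"
  assumes "ergodic B"
  shows "(\<lambda>r. (block_apply (block_rep B) ^^ r) x) \<longlonglongrightarrow> block_apply Omega x"
proof (rule columns_generated_by_units[where x = x])
  let ?F = "block_apply (block_rep B)"
  show "(\<lambda>r. (?F ^^ r) (y + z)) \<longlonglongrightarrow> block_apply Omega (y + z)"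
    if "(\<lambda>r. (?F ^^ r) y) \<longlonglongrightarrow> block_apply Omega y" "(\<lambda>r. (?F ^^ r) z) \<longlonglongrightarrow> block_apply Omega z"
    for y z
    using tendsto_add[OF that]
    by (simp add: linear_add[OF linear_funpow[OF linear_block_apply[OF linear_block_rep]]]
        linear_add[OF linear_block_apply[OF linear_Omega]])
  show "(\<lambda>r. (?F ^^ r) (cscale c y)) \<longlonglongrightarrow> block_apply Omega (cscale c y)"
    if "(\<lambda>r. (?F ^^ r) y) \<longlonglongrightarrow> block_apply Omega y" for c y
    using tendsto_cscale[OF that]
    by (simp add: funpow_cscale block_apply_rep_cscale block_apply_Omega_cscale)
  show "(\<lambda>r. (?F ^^ r) (axis j (matrix_unit a b))) \<longlonglongrightarrow> block_apply Omega (axis j (matrix_unit a b))"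
    for j a b
  proof (intro vec_tendstoI)
    fix p c d
    have *: "(?F ^^ r) (axis j X) $ p = block_power (block_rep B) r p j X" for r X
      by (simp add: block_apply_power[symmetric] linear_block_rep block_apply_axis
          linear_block_power linear_0)
    have "block_apply Omega (axis j X) $ p = Omega p j X" for X :: "'n cmat"
      by (simp add: block_apply_axis linear_Omega linear_0)
    with * assms show "(\<lambda>r. (?F ^^ r) (axis j (matrix_unit a b)) $ p $ c $ d)
        \<longlonglongrightarrow> block_apply Omega (axis j (matrix_unit a b)) $ p $ c $ d"
      by (simp add: ergodic_def)
  qed
qed

section \<open>The fundamental matrix\<close>

text \<open>Its powers are the terms of the fundamental matrix, which thereby becomes a Neumann
  series.\<close>

definition deviation ::
  "('k::finite \<Rightarrow> 'k \<Rightarrow> 'n::finite cmat) \<Rightarrow> 'n cmat ^ 'k \<Rightarrow> 'n cmat ^ 'k" where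
  "deviation B x = block_apply (block_rep B) x - block_apply Omega x"

lemma linear_deviation: "linear (deviation B)"
  unfolding deviation_def
  by (intro linear_compose_sub linear_block_apply linear_block_rep linear_Omega)

text \<open>The walk is continuous, and shifting an orbit by one step does not change its
  limit.\<close>

lemma block_rep_Omega:
  assumes "ergodic B"
  shows "block_apply (block_rep B) (block_apply Omega x) = block_apply Omega x"
proof (rule LIMSEQ_unique)
  let ?F = "block_apply (block_rep B)"
  have cont: "isCont ?F y" for y
    by (intro linear_continuous_at linear_conv_bounded_linear[THEN iffD1] linear_block_apply
        linear_block_rep)
  show "(\<lambda>r. (?F ^^ Suc r) x) \<longlonglongrightarrow> ?F (block_apply Omega x)"
    using isCont_tendsto_compose[OF cont ergodic_tendsto[OF assms]] by simp
  show "(\<lambda>r. (?F ^^ Suc r) x) \<longlonglongrightarrow> block_apply Omega x"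
    using ergodic_tendsto[OF assms] by (rule LIMSEQ_Suc)
qed

lemma Omega_cong:
  "total_trace x = total_trace y \<Longrightarrow> block_apply Omega x = block_apply Omega y"
  unfolding vec_eq_iff[of "block_apply Omega _"] block_apply_Omega by simp

text \<open>The walk fixes the range of \<open>Omega\<close>, and \<open>Omega\<close> kills columns
  of total trace 0, so the mixed terms cancel. The exponent is \<open>Suc r\<close> since the
  identity fails in general at power 0.\<close>

lemma deviation_funpow:
  assumes "oqw B" and "ergodic B"
  shows "(deviation B ^^ Suc r) x = (block_apply (block_rep B) ^^ Suc r) x - block_apply Omega x"
proof (induction r)
  case 0
  show ?case by (simp add: deviation_def)
next
  case (Suc r)
  let ?F = "block_apply (block_rep B)" and ?O = "block_apply Omega"
  have "(deviation B ^^ Suc (Suc r)) x = deviation B ((?F ^^ Suc r) x - ?O x)"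
    using Suc by simp
  then have "(deviation B ^^ Suc (Suc r)) x =
      ?F ((?F ^^ Suc r) x - ?O x) - ?O ((?F ^^ Suc r) x - ?O x)"
    by (simp only: deviation_def)
  also have "?F ((?F ^^ Suc r) x - ?O x) = (?F ^^ Suc (Suc r)) x - ?O x"
    by (simp add: linear_diff[OF linear_block_apply, OF linear_block_rep]
        block_rep_Omega[OF assms(2)])
  also have "?O ((?F ^^ Suc r) x - ?O x) = ?O 0"
    by (intro Omega_cong)
      (simp only: linear_diff[OF linear_total_trace] total_trace_funpow[OF assms(1)]
        total_trace_Omega linear_0[OF linear_total_trace] diff_self)
  finally show ?case
    by (simp add: linear_0[OF linear_block_apply[OF linear_Omega]])
qed

lemma deviation_tendsto_0:
  assumes "oqw B" and "ergodic B"
  shows "(\<lambda>r. (deviation B ^^ r) x) \<longlonglongrightarrow> 0"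
proof (rule LIMSEQ_imp_Suc)
  have "(\<lambda>r. (block_apply (block_rep B) ^^ Suc r) x - block_apply Omega x) \<longlonglongrightarrow> 0"
    using LIMSEQ_Suc[OF ergodic_tendsto[OF assms(2)]] by (rule LIM_zero)
  then show "(\<lambda>r. (deviation B ^^ Suc r) x) \<longlonglongrightarrow> 0"
    by (simp only: deviation_funpow[OF assms])
qed

text \<open>The term \<open>r = 0\<close> is the identity that \<open>fundamental\<close> writes
  separately.\<close>

definition fundamental_apply ::
  "('k::finite \<Rightarrow> 'k \<Rightarrow> 'n::finite cmat) \<Rightarrow> 'n cmat ^ 'k \<Rightarrow> 'n cmat ^ 'k" where
  "fundamental_apply B y = (\<Sum>r. (deviation B ^^ r) y)"

lemma fundamental_apply_axis:
  assumes "oqw B" and "ergodic B"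
  shows "fundamental_apply B (axis j X) $ i = fundamental B i j X"
proof -
  let ?y = "axis j X"
  note summable = summable_funpow(2)[OF linear_deviation deviation_tendsto_0[OF assms]]
  have Fpow: "(block_apply (block_rep B) ^^ r) ?y $ i = block_power (block_rep B) r i j X" for r
    by (simp add: block_apply_power[symmetric] linear_block_rep block_apply_axis
        linear_block_power linear_0)
  have "fundamental_apply B ?y = ?y + (\<Sum>r. (deviation B ^^ Suc r) ?y)"
    unfolding fundamental_apply_def using suminf_split_head[OF summable, of ?y] by simp
  then have "fundamental_apply B ?y $ i = ?y $ i + (\<Sum>r. (deviation B ^^ Suc r) ?y $ i)"
    using bounded_linear.suminf[OF bounded_linear_vec_nth, of "\<lambda>r. (deviation B ^^ Suc r) ?y" i]
      summable_Suc_iff[THEN iffD2, OF summable, of ?y]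
    by simp
  also have "(\<lambda>r. (deviation B ^^ Suc r) ?y $ i) =
      (\<lambda>r. block_power (block_rep B) (Suc r) i j X - Omega i j X)"
    unfolding deviation_funpow[OF assms] vector_minus_component Fpow
    by (simp add: block_apply_axis linear_Omega linear_0)
  also have "?y $ i = block_id i j X" by (simp add: axis_def block_id_def)
  finally show ?thesis by (simp only: fundamental_def)
qed

text \<open>Only the term \<open>r = 0\<close> carries trace: the walk and \<open>Omega\<close> both
  preserve it, so their differences have total trace 0.\<close>

lemma total_trace_fundamental:
  assumes "oqw B" and "ergodic B"
  shows "total_trace (fundamental_apply B y) = total_trace y"
proof -
  have "total_trace ((deviation B ^^ r) y) = (if r = 0 then total_trace y else 0)" for r
    by (cases r) (simp_all only: deviation_funpow[OF assms] linear_diff[OF linear_total_trace]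
        total_trace_funpow[OF assms(1)] total_trace_Omega, simp_all)
  then have "(\<lambda>r. total_trace ((deviation B ^^ r) y)) sums total_trace y"
    using sums_If_finite_set[of "{0::nat}" "\<lambda>r. total_trace y"] by simp
  moreover have "(\<lambda>r. total_trace ((deviation B ^^ r) y)) sums total_trace (fundamental_apply B y)"
    unfolding fundamental_apply_def
    by (intro bounded_linear.sums[OF linear_total_trace[unfolded linear_conv_bounded_linear]]
        summable_sums summable_funpow(2) linear_deviation deviation_tendsto_0 assms)
  ultimately show ?thesis by (rule sums_unique2[symmetric])
qed

text \<open>Applying \<open>deviation B\<close> shifts the Neumann series by one index, and
  \<open>Omega\<close> cannot tell \<open>y\<close> from its image because their total traces
  agree.\<close>

lemma fundamental_Poisson_equation:
  assumes "oqw B" and "ergodic B"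
  shows "fundamental_apply B y - block_apply (block_rep B) (fundamental_apply B y) =
    y - block_apply Omega y"
proof -
  let ?Z = "fundamental_apply B y"
  note summable = summable_funpow(2)[OF linear_deviation deviation_tendsto_0[OF assms]]
  have "deviation B ?Z = (\<Sum>r. deviation B ((deviation B ^^ r) y))"
    unfolding fundamental_apply_def
    by (rule bounded_linear.suminf[OF linear_deviation[unfolded linear_conv_bounded_linear] summable])
  also have "\<dots> = ?Z - y"
    unfolding fundamental_apply_def using suminf_split_head[OF summable, of y] by simp
  finally have "block_apply (block_rep B) ?Z - block_apply Omega ?Z = ?Z - y"
    by (simp add: deviation_def)
  moreover have "block_apply Omega ?Z = block_apply Omega y"
    by (intro Omega_cong total_trace_fundamental assms)
  ultimately show ?thesis by (simp add: algebra_simps)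
qed


section \<open>Survival away from a site\<close>

definition erase :: "'k::finite \<Rightarrow> 'n::finite cmat ^ 'k \<Rightarrow> 'n cmat ^ 'k" where
  "erase i x = (\<chi> p. if p = i then 0 else x $ p)"

text \<open>Erasure follows the step, so a start at \<open>i\<close> is kept: the visit at time 0
  does not count.\<close>

definition taboo_step ::
  "('k::finite \<Rightarrow> 'k \<Rightarrow> 'n::finite cmat) \<Rightarrow> 'k \<Rightarrow> 'n cmat ^ 'k \<Rightarrow> 'n cmat ^ 'k" where
  "taboo_step B i x = erase i (block_apply (block_rep B) x)"

definition rank1 :: "complex ^ 'n::finite \<Rightarrow> 'n cmat" where
  "rank1 v = (\<chi> a b. v $ a * cnj (v $ b))"

text \<open>A set of generators suffices: the cone of columns with positive semidefinite entries is
  spanned by the rank one projections, and closure under sums is all that is needed.\<close>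

inductive pos_column :: "'n::finite cmat ^ 'k::finite \<Rightarrow> bool" where
  zero: "pos_column 0"
| add_rank1: "pos_column x \<Longrightarrow> pos_column (x + axis j (rank1 v))"

text \<open>On positive columns the total trace is real, so there this is the total trace itself,
  made available for inequalities.\<close>

definition mass :: "'n::finite cmat ^ 'k::finite \<Rightarrow> real" where
  "mass x = Re (total_trace x)"

lemma linear_erase: "linear (erase i)"
  by (rule linearI) (auto simp: erase_def vec_eq_iff)

lemma erase_axis: "erase i (axis j X) = (if i = j then 0 else axis j X)"
  by (auto simp: erase_def vec_eq_iff axis_def)

lemma erase_plus_axis: "erase i x + axis i (x $ i) = x"
  by (auto simp: erase_def vec_eq_iff axis_def)

lemma linear_taboo_step: "linear (taboo_step B i)"
  unfolding taboo_step_def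
  using linear_compose[OF linear_block_apply[OF linear_block_rep] linear_erase] by (simp add: o_def)

lemma linear_mass: "linear mass"
  by (rule linearI)
    (simp_all add: mass_def linear_add[OF linear_total_trace] linear_cmul[OF linear_total_trace])

section \<open>Stability of the positive cone\<close>

lemma pos_column_add: "pos_column y \<Longrightarrow> pos_column x \<Longrightarrow> pos_column (x + y)"
  by (induction rule: pos_column.induct) (auto simp: add.assoc[symmetric] intro: add_rank1)

lemma pos_column_axis_rank1: "pos_column (axis j (rank1 v))"
  using add_rank1[OF zero] by simp

lemma pos_column_sum: "(\<And>s. s \<in> S \<Longrightarrow> pos_column (f s)) \<Longrightarrow> pos_column (\<Sum>s\<in>S. f s)"
  by (induction S rule: infinite_finite_induct) (auto intro: pos_column_add zero)

lemma pos_column_linear_image: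
  assumes "pos_column x" and "linear f" and "\<And>j v. pos_column (f (axis j (rank1 v)))"
  shows "pos_column (f x)"
  using assms(1)
  by induction (auto simp: linear_0[OF assms(2)] linear_add[OF assms(2)]
      intro: pos_column_add zero assms(3))

lemma conj_map_rank1: "conj_map C (rank1 v) = rank1 (C *v v)"
  by (simp add: vec_eq_iff conj_map_nth rank1_def matrix_vector_mult_def sum_product mult_ac)
    (subst sum.swap, simp)

text \<open>By \<open>conj_map_rank1\<close>, a generator at \<open>j\<close> is sent to one
  generator at each site.\<close>

lemma pos_column_block_rep:
  assumes "pos_column x"
  shows "pos_column (block_apply (block_rep B) x)"
proof (rule pos_column_linear_image[OF assms])
  show "linear (block_apply (block_rep B))"
    by (intro linear_block_apply linear_block_rep)
  fix j v
  have "block_apply (block_rep B) (axis j (rank1 v)) = (\<Sum>p\<in>UNIV. axis p (rank1 (B p j *v v)))"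
  proof (subst vec_eq_iff, intro allI)
    fix i
    have "axis p (rank1 (B p j *v v)) $ i = (if p = i then rank1 (B i j *v v) else 0)" for p
      by (simp add: axis_def)
    then show "block_apply (block_rep B) (axis j (rank1 v)) $ i =
        (\<Sum>p\<in>UNIV. axis p (rank1 (B p j *v v))) $ i"
      by (simp add: block_apply_axis linear_0[OF linear_block_rep])
        (simp add: block_rep_def conj_map_rank1)
  qed
  then show "pos_column (block_apply (block_rep B) (axis j (rank1 v)))"
    by (simp add: pos_column_sum pos_column_axis_rank1)
qed

lemma pos_column_erase: "pos_column x \<Longrightarrow> pos_column (erase i x)"
  by (erule pos_column_linear_image[OF _ linear_erase])
    (simp add: erase_axis zero pos_column_axis_rank1)

lemma pos_column_axis_nth:
  assumes "pos_column x"
  shows "pos_column (axis i (x $ i))"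
  using assms
proof (rule pos_column_linear_image)
  show "linear (\<lambda>x. axis i (x $ i))"
    by (rule linearI) (simp_all add: vec_eq_iff axis_def)
  fix j v
  show "pos_column (axis i (axis j (rank1 v) $ i))"
  proof (cases "i = j")
    case False
    then have "axis i (axis j (rank1 v) $ i) = 0"
      by (simp add: vec_eq_iff axis_def)
    then show ?thesis by (simp only: zero)
  qed (simp add: pos_column_axis_rank1)
qed

lemma pos_column_taboo_step: "pos_column x \<Longrightarrow> pos_column (taboo_step B i x)"
  unfolding taboo_step_def by (intro pos_column_erase pos_column_block_rep)

lemma pos_column_taboo_funpow: "pos_column x \<Longrightarrow> pos_column ((taboo_step B i ^^ r) x)"
  by (induction r) (auto intro: pos_column_taboo_step)

text \<open>Each new difference is the walk applied to the previous difference plus the entry just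
  erased at \<open>i\<close>, and both are positive.\<close>

lemma pos_column_taboo_diff:
  assumes "pos_column x"
  shows "pos_column ((block_apply (block_rep B) ^^ r) x - (taboo_step B i ^^ r) x)"
proof (induction r)
  case 0
  show ?case by (simp add: zero)
next
  case (Suc r)
  let ?F = "block_apply (block_rep B)"
  let ?x = "(?F ^^ r) x" and ?y = "(taboo_step B i ^^ r) x"
  have "?F ?x - taboo_step B i ?y = ?F (?x - ?y) + (?F ?y - erase i (?F ?y))"
    by (simp add: linear_diff[OF linear_block_apply, OF linear_block_rep] taboo_step_def)
  also have "?F ?y - erase i (?F ?y) = axis i (?F ?y $ i)"
    using erase_plus_axis[of i "?F ?y"] by (simp add: algebra_simps)
  finally show ?case
    using Suc assms
    by (simp add: pos_column_add pos_column_block_rep pos_column_axis_nth pos_column_taboo_funpow)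
qed

section \<open>Norm and mass on positive columns\<close>

lemma norm_rank1: "norm (rank1 v) = (norm v)\<^sup>2"
proof -
  have "norm (rank1 v $ a) = norm (v $ a) * norm v" for a
    by (simp add: rank1_def norm_vec_def norm_mult L2_set_right_distrib)
  then show ?thesis
    by (simp add: norm_vec_def[of "rank1 v"] L2_set_left_distrib[symmetric] power2_eq_square)
      (simp add: norm_vec_def)
qed

lemma mass_axis_rank1: "mass (axis j (rank1 v)) = (norm v)\<^sup>2"
  by (simp add: mass_def trace_def rank1_def norm_vec_def L2_set_def sum_nonneg
      complex_mult_cnj cmod_power2)

lemma norm_axis_eq: "norm (axis j X) = norm X"
proof -
  have "norm (axis j X $ p) ^ 2 = (if p = j then norm X ^ 2 else 0)" for p
    by (simp add: axis_def)
  then show ?thesis by (simp add: norm_vec_def[of "axis j X"] L2_set_def)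
qed

text \<open>Norm and mass coincide on rank one generators; the triangle inequality does the rest.
  Masses tending to 0 thus force columns to tend to 0.\<close>

lemma pos_column_norm_le_mass: "pos_column x \<Longrightarrow> norm x \<le> mass x"
proof (induction rule: pos_column.induct)
  case zero
  show ?case by (simp add: linear_0[OF linear_mass])
next
  case (add_rank1 x j v)
  have "norm (axis j (rank1 v)) \<le> mass (axis j (rank1 v))"
    by (simp add: norm_axis_eq norm_rank1 mass_axis_rank1)
  with add_rank1 norm_triangle_ineq[of x "axis j (rank1 v)"] show ?case
    by (simp add: linear_add[OF linear_mass])
qed

lemma pos_column_mass_nonneg: "pos_column x \<Longrightarrow> 0 \<le> mass x"
  using pos_column_norm_le_mass norm_ge_zero order_trans by blast

lemma mass_funpow: "oqw B \<Longrightarrow> mass ((block_apply (block_rep B) ^^ r) x) = mass x"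
  by (simp add: mass_def total_trace_funpow)

lemma mass_taboo_step_le:
  assumes "oqw B" and "pos_column x"
  shows "mass (taboo_step B i x) \<le> mass x"
proof -
  have "0 \<le> mass (block_apply (block_rep B) x - taboo_step B i x)"
    using pos_column_mass_nonneg[OF pos_column_taboo_diff[OF assms(2),
        where B = B and r = 1 and i = i]] by simp
  then show ?thesis
    using mass_funpow[OF assms(1), where r = 1 and x = x] by (simp add: linear_diff[OF linear_mass])
qed

text \<open>The positive difference of free and taboo evolution keeps nonnegative mass when its
  entry at \<open>i\<close> is erased. That entry is the full free one, since the last taboo step
  erased its own; the power \<open>Suc r\<close> ensures such a step.\<close>

lemma mass_taboo_funpow_le:
  assumes "oqw B" and "pos_column x"
  shows "mass ((taboo_step B i ^^ Suc r) x) \<le>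
    mass x - Re (trace ((block_apply (block_rep B) ^^ Suc r) x $ i))"
proof -
  let ?F = "block_apply (block_rep B)"
  define d where "d = (?F ^^ Suc r) x - (taboo_step B i ^^ Suc r) x"
  have "0 \<le> mass (erase i d)"
    unfolding d_def by (intro pos_column_mass_nonneg pos_column_erase pos_column_taboo_diff assms)
  also have "mass (erase i d) = mass d - mass (axis i (d $ i))"
    using erase_plus_axis[of i d] linear_add[OF linear_mass, of "erase i d" "axis i (d $ i)"] by simp
  also have "d $ i = (?F ^^ Suc r) x $ i"
    by (simp add: d_def taboo_step_def erase_def)
  also have "mass d = mass x - mass ((taboo_step B i ^^ Suc r) x)"
    unfolding d_def linear_diff[OF linear_mass] by (simp only: mass_funpow[OF assms(1)])
  finally show ?thesis by (simp add: mass_def)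
qed

text \<open>Uniformly in positive \<open>x\<close>, enough free steps put at least half the
  equilibrium share of the mass at \<open>i\<close>, and the taboo evolution has lost at least that
  much.\<close>

lemma taboo_contraction:
  fixes B :: "'k::finite \<Rightarrow> 'k \<Rightarrow> 'n::finite cmat"
  assumes "oqw B" and "ergodic B"
  obtains R \<theta> where "0 < R" "0 \<le> \<theta>" "\<theta> < 1"
    "\<And>x. pos_column x \<Longrightarrow> mass ((taboo_step B i ^^ R) x) \<le> \<theta> * mass x"
proof -
  obtain C q where Cq: "0 \<le> C" "0 \<le> q" "q < 1"
      "\<And>r x. norm ((deviation B ^^ r) x) \<le> C * q ^ r * norm x"
    using funpow_geometric_decay[OF linear_deviation deviation_tendsto_0[OF assms]] by blast
  have "linear (\<lambda>x :: 'n cmat ^ 'k. trace (x $ i))"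
    by (rule linearI) (simp_all add: linear_add[OF linear_trace] linear_cmul[OF linear_trace])
  then obtain M where M: "M > 0" "\<And>x :: 'n cmat ^ 'k. norm (trace (x $ i)) \<le> M * norm x"
    using linear_bounded_pos by blast
  let ?k = "real CARD('k)"
  have k: "1 \<le> ?k"
    using zero_less_card_finite[where 'a = 'k] by linarith
  have "(\<lambda>r. M * C * q ^ Suc r) \<longlonglongrightarrow> M * C * 0"
    using Cq by (intro tendsto_mult_left LIMSEQ_Suc LIMSEQ_realpow_zero)
  \<comment> \<open>The limiting share at \<open>i\<close> is \<open>1 / ?k\<close>; an error of at
    most half that size leaves the other half.\<close>
  then have "eventually (\<lambda>r. M * C * q ^ Suc r < 1 / (2 * ?k)) sequentially"
    by (rule order_tendstoD) simp
  then obtain r where r: "M * C * q ^ Suc r < 1 / (2 * ?k)"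
    by (metis (mono_tags, lifting) eventually_sequentially order_refl)
  have "mass ((taboo_step B i ^^ Suc r) x) \<le> (1 - 1 / (2 * ?k)) * mass x" if x: "pos_column x" for x
  proof -
    let ?t = "(block_apply (block_rep B) ^^ Suc r) x $ i"
    have "norm (trace ((deviation B ^^ Suc r) x $ i)) \<le> M * (C * q ^ Suc r * norm x)"
      using M(1) by (intro order_trans[OF M(2)] mult_left_mono Cq(4)) auto
    also have "\<dots> \<le> (M * C * q ^ Suc r) * mass x"
      using M(1) Cq pos_column_norm_le_mass[OF x] by (simp add: mult.assoc mult_left_mono)
    also have "\<dots> \<le> 1 / (2 * ?k) * mass x"
      using r pos_column_mass_nonneg[OF x] by (intro mult_right_mono) auto
    finally have "\<bar>Re (trace ((deviation B ^^ Suc r) x $ i))\<bar> \<le> 1 / (2 * ?k) * mass x"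
      using abs_Re_le_cmod order_trans by blast
    moreover have "trace ((deviation B ^^ Suc r) x $ i) = trace ?t - total_trace x / of_nat CARD('k)"
      by (simp only: deviation_funpow[OF assms] vector_minus_component linear_diff[OF linear_trace]
          block_apply_Omega trace_mat) simp
    ultimately have "mass x / ?k - 1 / (2 * ?k) * mass x \<le> Re (trace ?t)"
      by (simp add: mass_def)
    then show ?thesis
      using mass_taboo_funpow_le[OF assms(1) x, where i = i and r = r]
      by (simp add: left_diff_distrib)
  qed
  moreover have "0 \<le> 1 - 1 / (2 * ?k)" "1 - 1 / (2 * ?k) < 1"
    by (simp_all add: field_simps) (use k in linarith)
  ultimately show thesis using that[of "Suc r"] by blast
qed

text \<open>Masses decrease and decay geometrically along multiples of \<open>R\<close>, so the
  whole sequence of masses tends to 0 and bounds the norms.\<close>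

lemma taboo_tendsto_0_pos:
  fixes B :: "'k::finite \<Rightarrow> 'k \<Rightarrow> 'n::finite cmat"
  assumes "oqw B" and "ergodic B" and x: "pos_column x"
  shows "(\<lambda>r. (taboo_step B i ^^ r) x) \<longlonglongrightarrow> 0"
proof -
  let ?Q = "taboo_step B i"
  obtain R \<theta> where R: "0 < R" "0 \<le> \<theta>" "\<theta> < 1"
    "\<And>x. pos_column x \<Longrightarrow> mass ((?Q ^^ R) x) \<le> \<theta> * mass x"
    using taboo_contraction[OF assms(1,2)] by blast
  have bound: "mass ((?Q ^^ (R * m)) x) \<le> \<theta> ^ m * mass x" for m
  proof (induction m)
    case (Suc m)
    have "mass ((?Q ^^ (R * Suc m)) x) = mass ((?Q ^^ R) ((?Q ^^ (R * m)) x))"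
      by (simp add: funpow_add)
    also have "\<dots> \<le> \<theta> * mass ((?Q ^^ (R * m)) x)"
      by (intro R(4) pos_column_taboo_funpow x)
    also have "\<dots> \<le> \<theta> * (\<theta> ^ m * mass x)"
      by (intro mult_left_mono Suc R(2))
    finally show ?case by (simp add: mult.assoc)
  qed simp
  have nonneg: "0 \<le> mass ((?Q ^^ r) x)" for r
    by (intro pos_column_mass_nonneg pos_column_taboo_funpow x)
  have "decseq (\<lambda>r. mass ((?Q ^^ r) x))"
    by (intro decseq_SucI) (simp add: mass_taboo_step_le assms(1) pos_column_taboo_funpow x)
  then obtain L where L: "(\<lambda>r. mass ((?Q ^^ r) x)) \<longlonglongrightarrow> L"
    using decseq_convergent[of _ 0] nonneg by blast
  have "strict_mono (\<lambda>m. R * m)"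
    using R(1) by (intro strict_monoI) simp
  from LIMSEQ_subseq_LIMSEQ[OF L this] have "(\<lambda>m. mass ((?Q ^^ (R * m)) x)) \<longlonglongrightarrow> L"
    by (simp add: o_def)
  moreover have "(\<lambda>m. mass ((?Q ^^ (R * m)) x)) \<longlonglongrightarrow> 0"
  proof (rule tendsto_sandwich[of "\<lambda>_. 0"])
    show "(\<lambda>m. \<theta> ^ m * mass x) \<longlonglongrightarrow> 0"
      using R by (intro tendsto_mult_left_zero LIMSEQ_realpow_zero)
  qed (auto simp: nonneg bound)
  ultimately have "L = 0" by (rule LIMSEQ_unique)
  with L have "(\<lambda>r. mass ((?Q ^^ r) x)) \<longlonglongrightarrow> 0" by simp
  then show ?thesis
    by (rule Lim_null_comparison[rotated])
      (simp add: pos_column_norm_le_mass pos_column_taboo_funpow x)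
qed

text \<open>Weighting \<open>u w\<close> by \<open>w / 4\<close> over the fourth roots of unity
  keeps the cross term with \<open>cnj w\<close>, as \<open>w * cnj w = 1\<close>; the others cancel
  because the sums of \<open>w\<close> and of \<open>w\<^sup>2\<close> vanish.\<close>

lemma matrix_unit_polarization:
  fixes j :: "'k::finite" and a b :: "'n::finite"
  defines "u \<equiv> \<lambda>w. axis j (rank1 (axis a 1 + w *s axis b 1)) :: 'n cmat ^ 'k"
  shows "axis j (matrix_unit a b) =
    cscale (1 / 4) (u 1) + cscale (- 1 / 4) (u (- 1)) +
    cscale (\<i> / 4) (u \<i>) + cscale (- \<i> / 4) (u (- \<i>))"
proof -
  have polar: "z * w' = 1 / 4 * ((z + w) * (z' + w')) + - 1 / 4 * ((z - w) * (z' - w')) +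
      \<i> / 4 * ((z + \<i> * w) * (z' - \<i> * w')) + - \<i> / 4 * ((z - \<i> * w) * (z' + \<i> * w'))"
    for z w z' w' :: complex
    by (simp add: algebra_simps)
  have u_nth: "u w $ p $ c $ d = (if p = j then
      ((if c = a then 1 else 0) + w * (if c = b then 1 else 0)) *
      ((if d = a then 1 else 0) + cnj w * (if d = b then 1 else 0)) else 0)" for w p c d
    by (simp add: u_def axis_def rank1_def)
  show ?thesis
  proof (intro vec_eq_iff[THEN iffD2] allI)
    fix p c d
    let ?\<delta> = "\<lambda>s t. if s = t then 1 else 0 :: complex"
    have "axis j (matrix_unit a b) $ p $ c $ d = (if p = j then ?\<delta> c a * ?\<delta> d b else 0)"
      by (simp add: axis_def matrix_unit_def)
    then show "axis j (matrix_unit a b) $ p $ c $ d =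
        (cscale (1 / 4) (u 1) + cscale (- 1 / 4) (u (- 1)) +
         cscale (\<i> / 4) (u \<i>) + cscale (- \<i> / 4) (u (- \<i>))) $ p $ c $ d"
      using polar[of "?\<delta> c a" "?\<delta> d b" "?\<delta> c b" "?\<delta> d a"]
      by (simp add: cscale_def u_nth)
  qed
qed

lemma erase_cscale: "erase i (cscale c x) = cscale c (erase i x)"
  by (simp add: erase_def cscale_def vec_eq_iff)

text \<open>By polarization the positive columns span all columns over the complex numbers, so decay
  extends from the cone.\<close>

lemma taboo_tendsto_0:
  fixes B :: "'k::finite \<Rightarrow> 'k \<Rightarrow> 'n::finite cmat" and x :: "'n cmat ^ 'k"
  assumes "oqw B" and "ergodic B"
  shows "(\<lambda>r. (taboo_step B i ^^ r) x) \<longlonglongrightarrow> 0"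
proof (rule columns_generated_by_units[where x = x])
  let ?Q = "taboo_step B i" and ?P = "\<lambda>x. (\<lambda>r. (taboo_step B i ^^ r) x) \<longlonglongrightarrow> 0"
  show add: "?P (y + z)" if "?P y" "?P z" for y z
    using tendsto_add[OF that] by (simp add: linear_add[OF linear_funpow[OF linear_taboo_step]])
  show scale: "?P (cscale c y)" if "?P y" for c y
  proof -
    have "(?Q ^^ r) (cscale c y) = cscale c ((?Q ^^ r) y)" for r
      by (intro funpow_cscale) (simp add: taboo_step_def block_apply_rep_cscale erase_cscale)
    moreover have "cscale c 0 = (0 :: 'n cmat ^ 'k)"
      by (simp add: cscale_def vec_eq_iff)
    ultimately show ?thesis
      using tendsto_cscale[OF that, of c] by simp
  qed
  show "?P (axis j (matrix_unit a b))" for j a b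
    unfolding matrix_unit_polarization
    by (intro add scale taboo_tendsto_0_pos assms pos_column_axis_rank1)
qed

section \<open>Mean hitting times\<close>

lemma finite_first_visit_seqs: "finite (first_visit_seqs (i::'k::finite) j r)"
proof (rule finite_subset)
  show "first_visit_seqs i j r \<subseteq> {s. set s \<subseteq> UNIV \<and> length s = Suc r}"
    by (auto simp: first_visit_seqs_def)
qed (rule finite_lists_length_eq, simp)

lemma first_visit_seqs_1: "first_visit_seqs i j (Suc 0) = {[j, i]}"
  by (auto simp: first_visit_seqs_def length_Suc_conv)

text \<open>Dropping the start leaves a first-visit sequence from the second site, which must avoid
  \<open>i\<close> as a step still remains. The start \<open>j\<close> itself may be
  \<open>i\<close>.\<close>

lemma first_visit_seqs_Suc:
  "first_visit_seqs i j (Suc (Suc r)) = (\<Union>l\<in>- {i}. (#) j ` first_visit_seqs i l (Suc r))"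
proof (intro set_eqI iffI)
  fix s
  assume s: "s \<in> first_visit_seqs i j (Suc (Suc r))"
  then obtain t where t: "s = j # t"
    by (cases s) (auto simp: first_visit_seqs_def)
  have "t ! 0 \<noteq> i"
    using s t by (auto simp: first_visit_seqs_def dest!: spec[of _ "Suc 0"])
  moreover have "t ! m \<noteq> i" if "0 < m" "m < Suc r" for m
    using s t that by (auto simp: first_visit_seqs_def dest!: spec[of _ "Suc m"])
  ultimately have "t \<in> first_visit_seqs i (t ! 0) (Suc r)" "t ! 0 \<in> - {i}"
    using s t by (auto simp: first_visit_seqs_def)
  with t show "s \<in> (\<Union>l\<in>- {i}. (#) j ` first_visit_seqs i l (Suc r))" by blast
next
  fix s
  assume "s \<in> (\<Union>l\<in>- {i}. (#) j ` first_visit_seqs i l (Suc r))"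
  then obtain l t where t: "l \<noteq> i" "s = j # t" "t \<in> first_visit_seqs i l (Suc r)" by auto
  have "s ! m \<noteq> i" if "0 < m" "m < Suc (Suc r)" for m
  proof (cases "m = 1")
    case False
    with that obtain m' where "m = Suc m'" "0 < m'" "m' < Suc r" by (cases m) auto
    then show ?thesis using t by (simp add: first_visit_seqs_def)
  qed (use t in \<open>simp add: first_visit_seqs_def\<close>)
  with t show "s \<in> first_visit_seqs i j (Suc (Suc r))"
    by (simp add: first_visit_seqs_def)
qed

lemma linear_hit:
  "linear (\<lambda>x. block_apply (block_rep B) ((taboo_step B i ^^ r) x) $ i)"
  using linear_compose[OF linear_compose[OF linear_funpow[OF linear_taboo_step]
      linear_block_apply[OF linear_block_rep]] bounded_linear.linear[OF bounded_linear_vec_nth]]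
  by (simp add: o_def)

text \<open>Induction by conditioning on the first step: later matrices multiply on the left, so the
  first step acts on \<open>X\<close> first, and moving to the sites other than \<open>i\<close> is
  one taboo step.\<close>

lemma first_visit_sum:
  fixes B :: "'k::finite \<Rightarrow> 'k \<Rightarrow> 'n::finite cmat"
  shows "(\<Sum>s\<in>first_visit_seqs i j (Suc r). conj_map (seq_effect B s) X) =
    block_apply (block_rep B) ((taboo_step B i ^^ r) (axis j X)) $ i"
proof (induction r arbitrary: j X)
  case 0
  have "conj_map (mat 1 ** B i j) X = conj_map (B i j) X" by simp
  then show ?case
    by (simp add: first_visit_seqs_1 block_apply_axis linear_0[OF linear_block_rep])
      (simp add: block_rep_def)
next
  case (Suc r)
  let ?F = "block_apply (block_rep B)" and ?Q = "taboo_step B i"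
  let ?g = "\<lambda>x. ?F ((?Q ^^ r) x) $ i"
  note lin = linear_hit[where B = B and i = i and r = r]
  have effect: "conj_map (seq_effect B (j # s)) X = conj_map (seq_effect B s) (conj_map (B l j) X)"
    if "s \<in> first_visit_seqs i l (Suc r)" for l s
    using that by (cases s) (auto simp: first_visit_seqs_def conj_map_mult)
  have "(\<Sum>s\<in>first_visit_seqs i j (Suc (Suc r)). conj_map (seq_effect B s) X) =
      (\<Sum>l\<in>- {i}. \<Sum>s\<in>(#) j ` first_visit_seqs i l (Suc r). conj_map (seq_effect B s) X)"
    unfolding first_visit_seqs_Suc
    \<comment> \<open>Sequences for different \<open>l\<close> differ in their second site, so
      nothing is counted twice.\<close>
    by (rule sum.UNION_disjoint) (auto simp: finite_first_visit_seqs, auto simp: first_visit_seqs_def)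
  also have "\<dots> = (\<Sum>l\<in>- {i}. \<Sum>s\<in>first_visit_seqs i l (Suc r).
      conj_map (seq_effect B s) (conj_map (B l j) X))"
    by (simp add: sum.reindex effect)
  also have "\<dots> = ?g (\<Sum>l\<in>- {i}. axis l (conj_map (B l j) X))"
    by (simp add: Suc.IH linear_sum[OF lin])
  also have "(\<Sum>l\<in>- {i}. axis l (conj_map (B l j) X)) = ?Q (axis j X)"
  proof (subst vec_eq_iff, intro allI)
    fix p
    have "axis l (conj_map (B l j) X) $ p = (if l = p then conj_map (B p j) X else 0)" for l
      by (simp add: axis_def)
    moreover have "?F (axis j X) $ p = conj_map (B p j) X"
      by (simp add: block_apply_axis linear_0[OF linear_block_rep]) (simp add: block_rep_def)
    ultimately show "(\<Sum>l\<in>- {i}. axis l (conj_map (B l j) X)) $ p = ?Q (axis j X) $ p"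
      by (simp add: taboo_step_def erase_def)
  qed
  finally show ?case by (simp add: funpow_swap1)
qed

text \<open>Row \<open>i\<close> of the hitting time operator, summed as one series on a whole
  column so that the taboo evolution can be conditioned on its first step.\<close>

definition hit_mean ::
  "('k::finite \<Rightarrow> 'k \<Rightarrow> 'n::finite cmat) \<Rightarrow> 'k \<Rightarrow> 'n cmat ^ 'k \<Rightarrow> 'n cmat" where
  "hit_mean B i x =
    (\<Sum>r. real (Suc r) *\<^sub>R block_apply (block_rep B) ((taboo_step B i ^^ r) x) $ i)"

lemma hit_mean_axis: "hit_mean B i (axis j X) = mean_hitting_time B i j X"
  by (simp only: hit_mean_def mean_hitting_time_def first_visit_sum)

lemma summable_hit:
  assumes "oqw B" and "ergodic B"
  shows "summable (\<lambda>r. real (Suc r) *\<^sub>R block_apply (block_rep B) ((taboo_step B i ^^ r) x) $ i)"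
    and "summable (\<lambda>r. block_apply (block_rep B) ((taboo_step B i ^^ r) x) $ i)"
proof -
  let ?h = "\<lambda>x. block_apply (block_rep B) x $ i"
  have lin: "linear ?h"
    using linear_compose[OF linear_block_apply[OF linear_block_rep]
        bounded_linear.linear[OF bounded_linear_vec_nth]]
    by (simp add: o_def)
  then have bl: "bounded_linear ?h" by (simp add: linear_conv_bounded_linear)
  note summable = summable_funpow[OF linear_taboo_step taboo_tendsto_0[OF assms]]
  show "summable (\<lambda>r. real (Suc r) *\<^sub>R ?h ((taboo_step B i ^^ r) x))"
    using bounded_linear.summable[OF bl summable(1)] by (simp only: linear_cmul[OF lin])
  show "summable (\<lambda>r. ?h ((taboo_step B i ^^ r) x))"
    using bounded_linear.summable[OF bl summable(2)] .
qed

lemma linear_hit_mean: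
  assumes "oqw B" and "ergodic B"
  shows "linear (hit_mean B i)"
proof -
  let ?g = "\<lambda>r x. block_apply (block_rep B) ((taboo_step B i ^^ r) x) $ i"
  note lin = linear_hit[where B = B and i = i]
  note summable = summable_hit(1)[OF assms, of i]
  show ?thesis
  proof (rule linearI)
    show "hit_mean B i (x + y) = hit_mean B i x + hit_mean B i y" for x y
      unfolding hit_mean_def suminf_add[OF summable summable]
      by (simp only: linear_add[OF lin] scaleR_add_right)
    show "hit_mean B i (c *\<^sub>R x) = c *\<^sub>R hit_mean B i x" for c x
      unfolding hit_mean_def suminf_scaleR_right[OF summable]
      by (simp only: linear_cmul[OF lin] scaleR_left_commute)
  qed
qed

text \<open>Splitting the weight as \<open>r + 2 = 1 + (r + 1)\<close> separates the unweighted sum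
  of all hits from the mean after one taboo step.\<close>

lemma trace_hit_mean_first_step:
  assumes "oqw B" and "ergodic B"
  shows "trace (hit_mean B i x) = total_trace x + trace (hit_mean B i (taboo_step B i x))"
proof -
  let ?F = "block_apply (block_rep B)" and ?Q = "taboo_step B i"
  define f where "f r = ?F ((?Q ^^ r) x) $ i" for r
  note summable = summable_hit[OF assms, of i x, folded f_def]
  have "hit_mean B i x = f 0 + (\<Sum>r. real (Suc (Suc r)) *\<^sub>R f (Suc r))"
    unfolding hit_mean_def f_def[symmetric] using suminf_split_head[OF summable(1)] by simp
  also have "(\<Sum>r. real (Suc (Suc r)) *\<^sub>R f (Suc r)) =
      (\<Sum>r. f (Suc r) + real (Suc r) *\<^sub>R f (Suc r))"
    by (simp only: of_nat_Suc[of "Suc _"] scaleR_add_left scaleR_one)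
  also have "\<dots> = (\<Sum>r. f (Suc r)) + (\<Sum>r. real (Suc r) *\<^sub>R f (Suc r))"
    using summable_hit[OF assms, of i "?Q x"]
    by (intro suminf_add[symmetric]) (simp_all add: f_def funpow_swap1)
  also have "(\<Sum>r. real (Suc r) *\<^sub>R f (Suc r)) = hit_mean B i (?Q x)"
    by (simp add: hit_mean_def f_def funpow_swap1)
  finally have "hit_mean B i x = suminf f + hit_mean B i (?Q x)"
    using suminf_split_head[OF summable(2)] by simp
  \<comment> \<open>Almost sure hitting: each taboo step loses exactly the trace arriving at
    \<open>i\<close>, so the sum telescopes, and the surviving trace tends to 0.\<close>
  moreover have "trace (suminf f) = total_trace x"
  proof -
    have "trace (f r) = total_trace ((?Q ^^ r) x) - total_trace ((?Q ^^ Suc r) x)" for r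
    proof -
      let ?y = "?F ((?Q ^^ r) x)"
      have "total_trace ?y = total_trace (erase i ?y) + total_trace (axis i (?y $ i))"
        by (simp only: linear_add[OF linear_total_trace, symmetric] erase_plus_axis)
      then show ?thesis
        by (simp add: f_def taboo_step_def total_trace_block_rep[OF assms(1)])
    qed
    moreover have "(\<lambda>r. total_trace ((?Q ^^ r) x)) \<longlonglongrightarrow> total_trace (0 :: 'b cmat ^ 'a)"
      by (intro bounded_linear.tendsto[OF linear_total_trace[unfolded linear_conv_bounded_linear]]
          taboo_tendsto_0 assms)
    then have "(\<lambda>r. total_trace ((?Q ^^ r) x) - total_trace ((?Q ^^ Suc r) x)) sums total_trace x"
      using telescope_sums' by (fastforce simp: linear_0[OF linear_total_trace])
    moreover have "(\<lambda>r. trace (f r)) sums trace (suminf f)"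
      by (intro bounded_linear.sums[OF linear_trace[unfolded linear_conv_bounded_linear]]
          summable_sums summable)
    ultimately show ?thesis by (simp add: sums_unique2)
  qed
  ultimately show ?thesis by (simp add: linear_add[OF linear_trace])
qed

text \<open>Multiplying by a block-diagonal operator on either side involves a single block, so both
  inverse identities can be read off block by block.\<close>

lemma block_diag_inverse:
  assumes "block_is_inverse (block_diag_part A) C" and "\<And>p. A p p 0 = 0"
  shows "i \<noteq> j \<Longrightarrow> C i j X = 0" and "A i i (C i i X) = X"
proof -
  have C0: "C p q 0 = 0" for p q
    using assms(1) clinear_map_iff[of "C p q"]
    by (metis add_cancel_right_right block_is_inverse_def is_block_op_def)
  have AC: "A p p (C p q Y) = block_id p q Y" for p q Y
  proof -
    have "block_mult (block_diag_part A) C p q Y = A p p (C p q Y)"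
      by (simp add: block_mult_def block_diag_part_def if_distribR cong: if_cong)
    with assms(1) show ?thesis by (simp add: block_is_inverse_def)
  qed
  have CA: "C p q (A q q Y) = block_id p q Y" for p q Y
  proof -
    have "block_diag_part A l q Y = (if l = q then A q q Y else 0)" for l
      by (simp add: block_diag_part_def)
    then have "block_mult C (block_diag_part A) p q Y = C p q (A q q Y)"
      by (simp add: block_mult_def if_distrib[of "C p _"] C0 cong: if_cong)
    with assms(1) show ?thesis by (simp add: block_is_inverse_def)
  qed
  show "A i i (C i i X) = X" using AC[of i i X] by (simp add: block_id_def)
  assume "i \<noteq> j"
  \<comment> \<open>\<open>X\<close> is rewritten as \<open>A j j (C j j X)\<close>, on which
    \<open>C i j\<close> vanishes.\<close>
  then show "C i j X = 0"
    using CA[of i j "C j j X"] AC[of j j X] by (simp add: block_id_def)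
qed

theorem corollary2p5:
  fixes B :: "'k::finite \<Rightarrow> 'k \<Rightarrow> complex^'n::finite^'n"
    and Z K D N :: "('k, 'n) block_op"
    and \<rho> :: "complex^'n^'n"
    and i j :: 'k
  assumes "CARD('n) \<ge> 2" and "CARD('k) \<ge> 2"
    and "oqw B" and "ergodic B"
    and Z: "Z = fundamental B"
    and K: "K = mean_hitting_time B"
    and D: "D = block_diag_part K"
    and N: "N = (\<lambda>p q X. K p q X - D p q X)"
    and "block_invertible D"
    and "\<exists>c::complex. \<forall>p \<eta>. trace (K p p \<eta>) = c * trace \<eta>"
    and "density_matrix \<rho>"
  shows "trace (block_mult (block_inv D) N i j \<rho>) = trace (Z i i \<rho> - Z i j \<rho>)"
proof -
  note erg = \<open>oqw B\<close> \<open>ergodic B\<close>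
  obtain c :: complex where c: "\<And>p \<eta>. trace (K p p \<eta>) = c * trace \<eta>"
    using assms(10) by blast
  let ?F = "block_apply (block_rep B)" and ?Z = "fundamental_apply B"
  have K_axis: "K p q X = hit_mean B p (axis q X)" for p q X
    by (simp add: K hit_mean_axis)
  have axis_0: "axis q 0 = (0 :: 'n cmat ^ 'k)" for q
    by (simp add: vec_eq_iff axis_def)
  have K0: "K p q 0 = 0" for p q
    by (simp add: K_axis axis_0 linear_0[OF linear_hit_mean[OF erg]])
  \<comment> \<open>Erasing entry \<open>i\<close> first leaves out the diagonal block, so this is
    the trace of entry \<open>i\<close> of \<open>N x\<close>.\<close>
  define \<nu> where "\<nu> x = trace (hit_mean B i (erase i x))" for x
  have lin: "linear \<nu>"
    using linear_compose[OF linear_compose[OF linear_erase linear_hit_mean[OF erg]] linear_trace]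
    by (simp add: \<nu>_def[abs_def] o_def)
  \<comment> \<open>The erased entry contributes \<open>c * trace (x $ i)\<close> by the trace
    hypothesis on \<open>K\<close>; the rest is the first-step identity.\<close>
  have \<nu>_step: "\<nu> x + c * trace (x $ i) = total_trace x + \<nu> (?F x)" for x
  proof -
    have "hit_mean B i x = hit_mean B i (erase i x) + hit_mean B i (axis i (x $ i))"
      by (simp only: linear_add[OF linear_hit_mean[OF erg], symmetric] erase_plus_axis)
    then have "trace (hit_mean B i x) = \<nu> x + c * trace (x $ i)"
      by (simp add: \<nu>_def linear_add[OF linear_trace] c flip: K_axis)
    then show ?thesis
      using trace_hit_mean_first_step[OF erg, of i x] by (simp add: \<nu>_def taboo_step_def)
  qed
  \<comment> \<open>At \<open>?Z y\<close> the Poisson equation turns the change of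
    \<open>\<nu>\<close> under one step into \<open>\<nu>\<close> of \<open>y\<close> minus its
    equilibrium part.\<close>
  have \<nu>_Z: "\<nu> y = \<nu> (block_apply Omega y) + total_trace y - c * trace (?Z y $ i)" for y
  proof -
    have "\<nu> y - \<nu> (block_apply Omega y) = \<nu> (?Z y) - \<nu> (?F (?Z y))"
      by (simp only: linear_diff[OF lin, symmetric] fundamental_Poisson_equation[OF erg])
    also have "\<dots> = total_trace y - c * trace (?Z y $ i)"
      using \<nu>_step[of "?Z y"] by (simp add: total_trace_fundamental[OF erg] algebra_simps)
    finally show ?thesis by (simp add: algebra_simps)
  qed
  have \<nu>_axis: "\<nu> (axis q X) = trace (N i q X)" for q X
  proof (cases "i = q")
    case True
    then show ?thesis
      unfolding \<nu>_def N D block_diag_part_def erase_axis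
      by (simp add: linear_0[OF linear_hit_mean[OF erg]])
  next
    case False
    then show ?thesis
      unfolding \<nu>_def N D block_diag_part_def erase_axis
      by (simp add: K_axis)
  qed
  have "\<nu> (axis i \<rho>) = 0"
    unfolding \<nu>_axis N D block_diag_part_def by (simp add: linear_0[OF linear_trace])
  \<comment> \<open>Both columns have the trace of \<open>\<rho>\<close>, so the equilibrium terms
    cancel on subtraction.\<close>
  moreover have "block_apply Omega (axis i \<rho>) = block_apply Omega (axis j \<rho>)"
    by (rule Omega_cong) simp
  ultimately have key: "trace (N i j \<rho>) = c * trace (Z i i \<rho> - Z i j \<rho>)"
    using \<nu>_Z[of "axis i \<rho>"] \<nu>_Z[of "axis j \<rho>"] \<nu>_axis[of j \<rho>]
    by (simp add: fundamental_apply_axis[OF erg] Z linear_diff[OF linear_trace] algebra_simps)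
  have inv: "block_is_inverse (block_diag_part K) (block_inv D)"
    using \<open>block_invertible D\<close> unfolding block_invertible_def block_inv_def D by (rule someI_ex)
  have "block_mult (block_inv D) N i j \<rho> =
      (\<Sum>l\<in>UNIV. if l = i then block_inv D i i (N i j \<rho>) else 0)"
    unfolding block_mult_def
    by (rule sum.cong) (auto simp: block_diag_inverse(1)[OF inv K0])
  then have "block_mult (block_inv D) N i j \<rho> = block_inv D i i (N i j \<rho>)"
    by simp
  moreover have trace_inv: "c * trace (block_inv D i i X) = trace X" for X
    using block_diag_inverse(2)[OF inv K0, of i X] c[of i "block_inv D i i X"] by simp
  \<comment> \<open>With \<open>c = 0\<close> every trace would vanish, yet the identity matrix has
    trace \<open>n\<close>.\<close>
  have "c \<noteq> 0"
    using trace_inv[of "mat 1"] by (auto simp: trace_mat)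
  then have "trace (block_inv D i i (N i j \<rho>)) = trace (Z i i \<rho> - Z i j \<rho>)"
    by (rule mult_left_cancel[THEN iffD1]) (simp only: trace_inv key)
  ultimately show ?thesis by simp
qed

end
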